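(* Let $\delta\in\mathbb{C}$, let $(\mathcal{A},\cdot)$ be a commutative associative algebra over $\mathbb{C}$, and let $\varphi_1,\varphi_2$ be commuting nonzero $\delta$-derivations of $\mathcal{A}$ (i.e. $\varphi_1\varphi_2=\varphi_2\varphi_1$). Define $$[\![ x,y]\!]=\varphi_1(x)\varphi_2(y)-\varphi_2(x)\varphi_1(y),\qquad x,y\in\mathcal{A}.$$ Then $(\mathcal{A},\cdot,[\![\cdot,\cdot]\!])$ is a $\delta$-Poisson algebra.
   Context: A $\delta$-derivation of an algebra $\mathcal{A}$ is a linear map $\varphi:\mathcal{A}\to\mathcal{A}$ with $\varphi(xy)=\delta(\varphi(x)y+x\varphi(y))$ for all $x,y$. A $\delta$-Poisson algebra is a triple $(P,\cdot,\{\cdot,\cdot\})$ such that $(P,\cdot)$ is a commutative associative algebra, $(P,\{\cdot,\cdot\})$ is a Lie algebra, and $\{xy,z\}=\delta\big(x\{y,z\}+\{x,z\}y\big)$ for all $x,y,z\in P$. *)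

theory Defs
  imports Complex_Main
begin

text \<open>Algebras need be neither unital nor finite-dimensional.  The underlying vector space is the
  whole type \<open>'a\<close>, with an arbitrary scalar multiplication \<open>scale\<close> over the field \<open>'k\<close>.\<close>

locale nonassoc_algebra = vector_space scale
  for scale :: "'k::field \<Rightarrow> 'a::ab_group_add \<Rightarrow> 'a" +
  fixes mult :: "'a \<Rightarrow> 'a \<Rightarrow> 'a"
  assumes linear_mult_right: "Vector_Spaces.linear scale scale (\<lambda>y. mult x y)"
    and linear_mult_left: "Vector_Spaces.linear scale scale (\<lambda>x. mult x y)"

locale comm_assoc_algebra = nonassoc_algebra scale mult
  for scale :: "'k::field \<Rightarrow> 'a::ab_group_add \<Rightarrow> 'a" and mult :: "'a \<Rightarrow> 'a \<Rightarrow> 'a" +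
  assumes mult_commute: "mult x y = mult y x"
    and mult_assoc: "mult (mult x y) z = mult x (mult y z)"

locale lie_algebra = nonassoc_algebra scale bracket
  for scale :: "'k::field \<Rightarrow> 'a::ab_group_add \<Rightarrow> 'a" and bracket :: "'a \<Rightarrow> 'a \<Rightarrow> 'a" +
  assumes alternating: "bracket x x = 0"
    and jacobi: "bracket (bracket x y) z + bracket (bracket y z) x + bracket (bracket z x) y = 0"

locale delta_derivation =
  nonassoc_algebra scale mult + Vector_Spaces.linear scale scale \<phi>
  for scale :: "'k::field \<Rightarrow> 'a::ab_group_add \<Rightarrow> 'a" and mult :: "'a \<Rightarrow> 'a \<Rightarrow> 'a"
    and \<delta> :: 'k and \<phi> :: "'a \<Rightarrow> 'a" +
  assumes delta_leibniz: "\<phi> (mult x y) = scale \<delta> (mult (\<phi> x) y + mult x (\<phi> y))"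

locale delta_Poisson_algebra =
  comm_assoc_algebra scale mult + lie: lie_algebra scale bracket
  for scale :: "'k::field \<Rightarrow> 'a::ab_group_add \<Rightarrow> 'a" and \<delta> :: 'k
    and mult :: "'a \<Rightarrow> 'a \<Rightarrow> 'a" and bracket :: "'a \<Rightarrow> 'a \<Rightarrow> 'a" +
  assumes delta_Poisson:
    "bracket (mult x y) z = scale \<delta> (mult x (bracket y z) + mult (bracket x z) y)"

end

theory Submission
  imports Defs
begin

text \<open>
  The bracket is the Jacobian determinant of the pair of maps \<open>D, E\<close>. Bilinearity and
  \<open>[x, x] = 0\<close> are immediate, and the \<open>\<delta>\<close>-Poisson identity is the \<open>\<delta>\<close>-Leibniz rule applied to
  \<open>D (x y)\<close> and \<open>E (x y)\<close>. For the Jacobi identity, the \<open>\<delta>\<close>-Leibniz rule is used exactly once in each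
  term: \<open>[[x, y], z]\<close> contains one derivation of a product of two factors, each of which is already
  a value of \<open>D\<close> or \<open>E\<close>. Hence \<open>\<delta>\<close> appears only as a common factor, and what it multiplies is the
  expression known from the classical case \<open>\<delta> = 1\<close>, whose cyclic sum vanishes because \<open>D\<close> and \<open>E\<close>
  commute.
\<close>

context comm_assoc_algebra
begin

lemma mult_add_right: "mult x (y + z) = mult x y + mult x z"
  and mult_diff_right: "mult x (y - z) = mult x y - mult x z"
  and mult_scale_right: "mult x (scale c y) = scale c (mult x y)"
proof -
  interpret Vector_Spaces.linear scale scale "\<lambda>y. mult x y" by (rule linear_mult_right)
  show "mult x (y + z) = mult x y + mult x z" by (rule add)
  show "mult x (y - z) = mult x y - mult x z" by (rule diff)
  show "mult x (scale c y) = scale c (mult x y)" by (rule scale)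
qed

lemma mult_add_left: "mult (x + y) z = mult x z + mult y z"
  and mult_diff_left: "mult (x - y) z = mult x z - mult y z"
  and mult_scale_left: "mult (scale c x) z = scale c (mult x z)"
  by (simp_all add: mult_commute[of _ z] mult_add_right mult_diff_right mult_scale_right)

lemma mult_left_commute: "mult x (mult y z) = mult y (mult x z)"
  by (metis mult_assoc mult_commute)

lemmas mult_distribs = mult_add_left mult_add_right mult_diff_left mult_diff_right

lemmas mult_ac = mult_assoc mult_commute mult_left_commute

end

locale commuting_delta_derivations =
  comm_assoc_algebra scale mult +
  D: delta_derivation scale mult \<delta> D + E: delta_derivation scale mult \<delta> E
  for scale :: "'k::field \<Rightarrow> 'a::ab_group_add \<Rightarrow> 'a" and mult :: "'a \<Rightarrow> 'a \<Rightarrow> 'a"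
    and \<delta> :: 'k and D E :: "'a \<Rightarrow> 'a" +
  assumes derivations_commute: "D (E x) = E (D x)"
begin

definition jacobian :: "'a \<Rightarrow> 'a \<Rightarrow> 'a"
  where "jacobian x y = mult (D x) (E y) - mult (E x) (D y)"

lemma nonassoc_algebra_jacobian: "nonassoc_algebra scale jacobian"
proof
  fix x y z c
  show "jacobian x (y + z) = jacobian x y + jacobian x z"
    and "jacobian (y + z) x = jacobian y x + jacobian z x"
    by (simp_all add: jacobian_def D.add E.add mult_distribs)
  show "jacobian x (scale c y) = scale c (jacobian x y)"
    and "jacobian (scale c y) x = scale c (jacobian y x)"
    by (simp_all add: jacobian_def D.scale E.scale mult_scale_left mult_scale_right
        scale_right_diff_distrib)
qed

lemma jacobian_self: "jacobian x x = 0"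
  by (simp add: jacobian_def mult_commute)

text \<open>This is the only place where the \<open>\<delta>\<close>-Leibniz rule enters the proof of the Jacobi identity.
  The result is \<open>\<delta>\<close> times an expression not involving \<open>\<delta>\<close>, with the mixed second derivatives
  already identified.\<close>

lemma jacobian_jacobian:
  "jacobian (jacobian x y) z = scale \<delta>
    (mult (mult (D (D x)) (E y) + mult (D x) (E (D y))
         - mult (E (D x)) (D y) - mult (E x) (D (D y))) (E z)
   - mult (mult (E (D x)) (E y) + mult (D x) (E (E y))
         - mult (E (E x)) (D y) - mult (E x) (E (D y))) (D z))"
  by (simp add: jacobian_def D.diff E.diff D.delta_leibniz E.delta_leibniz derivations_commute
      mult_scale_left algebra_simps
      flip: scale_right_diff_distrib scale_right_distrib)

text \<open>Every monomial carries one second derivative, and those with a second derivative of \<open>x\<close> come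
  from \<open>[[x, y], z]\<close> and \<open>[[z, x], y]\<close> only. In the first, \<open>D (D x)\<close> has coefficient \<open>E y E z\<close>,
  \<open>E (E x)\<close> has \<open>D y D z\<close>, and \<open>E (D x)\<close> has \<open>- (D y E z + E y D z)\<close>. These are symmetric in \<open>y\<close>
  and \<open>z\<close>, and the second bracket has the same coefficients with the opposite sign.\<close>

lemma jacobian_jacobi:
  "jacobian (jacobian x y) z + jacobian (jacobian y z) x + jacobian (jacobian z x) y = 0"
proof -
  have "jacobian (jacobian x y) z + jacobian (jacobian y z) x + jacobian (jacobian z x) y
      = scale \<delta> 0"
    unfolding jacobian_jacobian scale_right_distrib[symmetric]
    by (rule arg_cong[where f = "scale \<delta>"]) (simp add: mult_distribs mult_ac)
  then show ?thesis by simp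
qed

lemma jacobian_delta_Poisson:
  "jacobian (mult x y) z = scale \<delta> (mult x (jacobian y z) + mult (jacobian x z) y)"
  unfolding jacobian_def D.delta_leibniz E.delta_leibniz mult_scale_left
    scale_right_diff_distrib[symmetric]
  by (rule arg_cong[where f = "scale \<delta>"]) (simp add: mult_distribs mult_ac)

lemma delta_Poisson_algebra_jacobian: "delta_Poisson_algebra scale \<delta> mult jacobian"
proof -
  interpret jacobian: nonassoc_algebra scale jacobian
    by (rule nonassoc_algebra_jacobian)
  show ?thesis
    by unfold_locales (rule jacobian_self jacobian_jacobi jacobian_delta_Poisson)+
qed

end

theorem theorem38:
  fixes scale :: "complex \<Rightarrow> 'a::ab_group_add \<Rightarrow> 'a"
    and mult :: "'a \<Rightarrow> 'a \<Rightarrow> 'a"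
    and \<delta> :: complex
    and \<phi>\<^sub>1 \<phi>\<^sub>2 :: "'a \<Rightarrow> 'a"
  assumes "comm_assoc_algebra scale mult"
    and "delta_derivation scale mult \<delta> \<phi>\<^sub>1"
    and "delta_derivation scale mult \<delta> \<phi>\<^sub>2"
    and "\<phi>\<^sub>1 \<noteq> (\<lambda>_. 0)"
    and "\<phi>\<^sub>2 \<noteq> (\<lambda>_. 0)"
    and "\<phi>\<^sub>1 \<circ> \<phi>\<^sub>2 = \<phi>\<^sub>2 \<circ> \<phi>\<^sub>1"
  shows "delta_Poisson_algebra scale \<delta> mult
    (\<lambda>x y. mult (\<phi>\<^sub>1 x) (\<phi>\<^sub>2 y) - mult (\<phi>\<^sub>2 x) (\<phi>\<^sub>1 y))"
proof -
  have "\<phi>\<^sub>1 (\<phi>\<^sub>2 x) = \<phi>\<^sub>2 (\<phi>\<^sub>1 x)" for x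
    using assms(6) by (rule comp_eq_dest)
  then interpret commuting_delta_derivations scale mult \<delta> \<phi>\<^sub>1 \<phi>\<^sub>2
    using assms(1-3)
    by (intro commuting_delta_derivations.intro commuting_delta_derivations_axioms.intro)
  show ?thesis
    using delta_Poisson_algebra_jacobian unfolding jacobian_def .
qed

end
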